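(* Let $\Sigma$ be a complete separable metric space, $\mu$ a Borel probability measure on $\Sigma$, and $\ell:\Sigma\to[0,\infty)$ a bounded continuous function. Every $\nu\in\mathcal{M}_1(\Sigma)$, with $\xi=\nu-\mu$, satisfies $$\int_\Sigma\ell\,d\nu\ge\Big\{\inf_{x\in\Sigma}\ell(x)-\sup_{x\in\Sigma}\ell(x)\Big\}\frac{\|\xi\|_{TV}}{2}+\int_\Sigma\ell\,d\mu .$$ Let $x^0\in\Sigma^0=\{x\in\Sigma:\ell(x)=\sup_{y\in\Sigma}\ell(y)\}$ and $x_0\in\Sigma_0=\{x\in\Sigma:\ell(x)=\inf_{y\in\Sigma}\ell(y)\}$. The lower bound is achieved by the signed measure $\xi^*\in\widetilde{\mathbb B}_R(\mu)$ given by $$\xi^*=\nu^*-\mu=\frac{R}{2}\left(\delta_{x_0}-\delta_{x^0}\right),$$ which has total variation $\|\xi^*\|_{TV}=\|\nu^*-\mu\|_{TV}=R$, and for which $$\int_\Sigma\ell\,d\nu^*=\frac R2\Big\{\inf_{x\in\Sigma}\ell(x)-\sup_{x\in\Sigma}\ell(x)\Big\}+\int_\Sigma\ell\,d\mu .$$ Solving this for $R$, for every $D\in[0,\infty)$ with $D<\int_\Sigma\ell\,d\mu$, $$R^-(D)=\frac{2\left(D-\int_\Sigma\ell\,d\mu\right)}{\inf_{x\in\Sigma}\ell(x)-\sup_{x\in\Sigma}\ell(x)},$$ where $\nu^*$ satisfies the constraint $\int_\Sigma\ell\,d\nu^*=D$, is normalized, $\nu^*(\Sigma)=1$, and satisfies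 $0\le\nu^*(A)\le1$ for every Borel set $A\subseteq\Sigma$.
   Context: $\mathcal{M}_1(\Sigma)$ is the set of Borel probability measures on $\Sigma$, and $\delta_y$ is the Dirac measure at $y$. The total variation distance is $\|\alpha-\beta\|_{TV}=\sup_{P}\sum_{F\in P}|\alpha(F)-\beta(F)|$, the supremum being over all finite measurable partitions $P$ of $\Sigma$ (so it takes values in $[0,2]$ on probability measures); for a finite signed measure $\eta$ with Jordan decomposition $\eta=\eta^+-\eta^-$, $\|\eta\|_{TV}=\eta^+(\Sigma)+\eta^-(\Sigma)$. $\widetilde{\mathbb B}_R(\mu)$ is the set of finite signed measures $\xi$ on $\Sigma$ with $\xi(\Sigma)=0$, $\xi=\nu-\mu$ for some $\nu\in\mathcal{M}_1(\Sigma)$, and $\|\xi\|_{TV}\le R$. The extremum problem is $R^-(D)=\inf\big\{\|\nu-\mu\|_{TV}:\ \nu\in\mathcal{M}_1(\Sigma),\ \int_\Sigma\ell\,d\nu\le D\big\}$.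
   Formalization: All claims about ξ*, ν* and R^-(D) are proved for R ≥ 0 under the condition that ν*(A) ≥ 0 for every Borel A (false in general otherwise); ‖ξ*‖_TV = R assumes x_0 ≠ x^0, and the R^-(D) formula assumes inf ℓ ≠ sup ℓ. *)

theory Defs
  imports "HOL-Probability.Probability"
begin

definition prob_measures :: "'a::topological_space measure set" where
  "prob_measures = {\<nu>. sets \<nu> = sets borel \<and> prob_space \<nu>}"

definition tv_dist :: "'a::topological_space measure \<Rightarrow> 'a measure \<Rightarrow> real" where
  "tv_dist \<alpha> \<beta> =
     (SUP P \<in> {P. finite P \<and> P \<subseteq> sets borel \<and> partition_on UNIV P}.
        \<Sum>F\<in>P. \<bar>measure \<alpha> F - measure \<beta> F\<bar>)"

text \<open>Finite signed Borel measures are real-valued set functions. They are normalised to vanish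
  outside the Borel sets, as \<^const>\<open>measure\<close> does, so that equality of functions is
  equality of signed measures.\<close>

definition finite_signed_measure :: "('a::topological_space set \<Rightarrow> real) \<Rightarrow> bool" where
  "finite_signed_measure \<eta> \<longleftrightarrow>
     \<eta> {} = 0 \<and> (\<forall>A. A \<notin> sets borel \<longrightarrow> \<eta> A = 0) \<and>
     (\<forall>A :: nat \<Rightarrow> 'a set. range A \<subseteq> sets borel \<longrightarrow> disjoint_family A \<longrightarrow>
        (\<lambda>n. \<eta> (A n)) sums \<eta> (\<Union>n. A n))"

definition jordan_decomposition ::
  "('a::topological_space set \<Rightarrow> real) \<Rightarrow> 'a measure \<Rightarrow> 'a measure \<Rightarrow> bool" where
  "jordan_decomposition \<eta> p n \<longleftrightarrow>
     sets p = sets borel \<and> finite_measure p \<and> sets n = sets borel \<and> finite_measure n \<and>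
     (\<exists>P\<in>sets borel. measure p (- P) = 0 \<and> measure n P = 0) \<and>
     (\<forall>A\<in>sets borel. \<eta> A = measure p A - measure n A)"

definition tv_norm :: "('a::topological_space set \<Rightarrow> real) \<Rightarrow> real" where
  "tv_norm \<eta> =
     (THE t. \<exists>p n. jordan_decomposition \<eta> p n \<and> t = measure p UNIV + measure n UNIV)"

definition measure_diff ::
  "'a::topological_space measure \<Rightarrow> 'a measure \<Rightarrow> 'a set \<Rightarrow> real" where
  "measure_diff \<nu> \<mu> = (\<lambda>A. measure \<nu> A - measure \<mu> A)"

definition signed_ball :: "'a::topological_space measure \<Rightarrow> real \<Rightarrow> ('a set \<Rightarrow> real) set" where
  "signed_ball \<mu> R =
     {\<xi>. finite_signed_measure \<xi> \<and> \<xi> UNIV = 0 \<and>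
          (\<exists>\<nu>\<in>prob_measures. \<xi> = measure_diff \<nu> \<mu>) \<and> tv_norm \<xi> \<le> R}"

text \<open>The infimum is taken in the extended reals, hence is \<open>\<infinity>\<close> if no \<open>\<nu>\<close> meets
  the constraint.\<close>

definition R_minus :: "'a::topological_space measure \<Rightarrow> ('a \<Rightarrow> real) \<Rightarrow> real \<Rightarrow> ereal" where
  "R_minus \<mu> l D =
     (INF \<nu> \<in> {\<nu> \<in> prob_measures. (\<integral>x. l x \<partial>\<nu>) \<le> D}. ereal (tv_dist \<nu> \<mu>))"

definition argmax_set :: "('a \<Rightarrow> real) \<Rightarrow> 'a set" where
  "argmax_set l = {x. l x = (SUP y. l y)}"

definition argmin_set :: "('a \<Rightarrow> real) \<Rightarrow> 'a set" where
  "argmin_set l = {x. l x = (INF y. l y)}"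

text \<open>In \<open>xi_star\<close> and \<open>nu_star\<close>, mass \<open>R / 2\<close> is moved from the maximum point \<open>xmax\<close>
  (\<open>x\<^sup>0\<close> in the mathematics) to the minimum point \<open>xmin\<close> (\<open>x\<^sub>0\<close>).\<close>

definition xi_star :: "real \<Rightarrow> 'a::topological_space \<Rightarrow> 'a \<Rightarrow> 'a set \<Rightarrow> real" where
  "xi_star R xmin xmax =
     (\<lambda>A. R / 2 * (measure (return borel xmin) A - measure (return borel xmax) A))"

text \<open>A priori \<open>\<mu> + xi_star\<close> is only a signed measure: \<open>nu_star\<close> may be negative at the
  singleton of \<open>xmax\<close>. \<open>nu_star_measure\<close> is the same object as an element of the measure type,
  and is meaningful exactly when \<open>nu_star\<close> is nonnegative.\<close>

definition nu_star ::
  "'a::topological_space measure \<Rightarrow> real \<Rightarrow> 'a \<Rightarrow> 'a \<Rightarrow> 'a set \<Rightarrow> real" where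
  "nu_star \<mu> R xmin xmax = (\<lambda>A. measure \<mu> A + xi_star R xmin xmax A)"

definition nu_star_measure ::
  "'a::topological_space measure \<Rightarrow> real \<Rightarrow> 'a \<Rightarrow> 'a \<Rightarrow> 'a measure" where
  "nu_star_measure \<mu> R xmin xmax =
     measure_of UNIV (sets borel) (\<lambda>A. ennreal (nu_star \<mu> R xmin xmax A))"

end

theory Submission imports Defs begin

text \<open>Let \<open>p - n\<close> be the Jordan decomposition of \<open>\<xi> = \<nu> - \<mu>\<close>. Both parts have mass
  \<open>\<parallel>\<xi>\<parallel> / 2\<close>, since \<open>\<xi>\<close> has total mass \<open>0\<close>, so
  \<open>\<integral>l d\<nu> - \<integral>l d\<mu> = \<integral>l dp - \<integral>l dn \<ge> (inf l - sup l) \<parallel>\<xi>\<parallel> / 2\<close>. Equality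
  holds when \<open>p\<close> sits at a minimum point and \<open>n\<close> at a maximum point of \<open>l\<close>.\<close>

section \<open>Finite signed measures and their Jordan decompositions\<close>

lemma finite_signed_measure_measure_diff:
  assumes "sets \<nu> = sets borel" "finite_measure \<nu>" "sets \<mu> = sets borel" "finite_measure \<mu>"
  shows "finite_signed_measure (measure_diff \<nu> \<mu>)"
proof -
  interpret n: finite_measure \<nu> by fact
  interpret m: finite_measure \<mu> by fact
  show ?thesis
    unfolding finite_signed_measure_def measure_diff_def
    using assms by (auto simp: measure_notin_sets intro!: sums_diff n.finite_measure_UNION m.finite_measure_UNION)
qed

lemma finite_signed_measure_uminus:
  assumes "finite_signed_measure \<eta>"
  shows "finite_signed_measure (\<lambda>A. - \<eta> A)"
  using assms unfolding finite_signed_measure_def by (auto intro: sums_minus)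

text \<open>The guard keeps the normalisation to \<open>0\<close> outside the Borel sets:
  \<open>A \<inter> P\<close> can be Borel, with \<open>\<eta> (A \<inter> P)\<close> nonzero,
  although \<open>A\<close> is not.\<close>

lemma finite_signed_measure_restrict:
  assumes "finite_signed_measure \<eta>" "P \<in> sets borel"
  shows "finite_signed_measure (\<lambda>A. if A \<in> sets borel then \<eta> (A \<inter> P) else 0)"
  unfolding finite_signed_measure_def
proof (intro conjI allI impI)
  fix A :: "nat \<Rightarrow> 'a set" assume A: "range A \<subseteq> sets borel" "disjoint_family A"
  have "(\<lambda>n. \<eta> (A n \<inter> P)) sums \<eta> (\<Union>n. A n \<inter> P)"
    using assms A unfolding finite_signed_measure_def
    by (auto simp: disjoint_family_on_def range_subsetD elim!: allE[where x = "\<lambda>n. A n \<inter> P"])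
  moreover have "(\<Union>n. A n \<inter> P) = (\<Union>n. A n) \<inter> P" by auto
  moreover have "A n \<in> sets borel" for n using A by auto
  ultimately show "(\<lambda>n. if A n \<in> sets borel then \<eta> (A n \<inter> P) else 0) sums
      (if (\<Union>n. A n) \<in> sets borel then \<eta> ((\<Union>n. A n) \<inter> P) else 0)"
    by auto
qed (use assms in \<open>auto simp: finite_signed_measure_def\<close>)

text \<open>This passes from set functions to the measure type; it yields both Jordan parts and
  later \<nu>*. The last conclusion is an equality of functions on all sets, because off the Borel
  sets \<open>measure\<close> and a finite signed measure both take the value
  \<open>0\<close>.\<close>

lemma measure_of_finite_signed_measure:
  assumes \<eta>: "finite_signed_measure \<eta>" and nonneg: "\<forall>A\<in>sets borel. 0 \<le> \<eta> A"
  defines "M \<equiv> measure_of UNIV (sets borel) (\<lambda>A. ennreal (\<eta> A))"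
  shows "sets M = sets borel" "finite_measure M" "measure M = \<eta>"
proof -
  show s: "sets M = sets borel"
    unfolding M_def by (metis sets.sets_measure_of_eq space_borel)
  have em: "emeasure M A = ennreal (\<eta> A)" if "A \<in> sets borel" for A
  proof (rule emeasure_measure_of[OF M_def[THEN meta_eq_to_obj_eq]])
    show "positive (sets M) (\<lambda>A. ennreal (\<eta> A))"
      using \<eta> by (simp add: positive_def finite_signed_measure_def)
    show "countably_additive (sets M) (\<lambda>A. ennreal (\<eta> A))"
      unfolding countably_additive_def s
    proof (intro allI impI)
      fix A :: "nat \<Rightarrow> 'a set"
      assume A: "range A \<subseteq> sets borel" "disjoint_family A"
      then have "(\<lambda>n. \<eta> (A n)) sums \<eta> (\<Union>n. A n)"
        using \<eta> by (auto simp: finite_signed_measure_def)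
      then show "(\<Sum>n. ennreal (\<eta> (A n))) = ennreal (\<eta> (\<Union>n. A n))"
        using A nonneg by (auto simp: suminf_ennreal2 sums_iff)
    qed
  qed (use that s in auto)
  have sp: "space M = UNIV" using s sets_eq_imp_space_eq[OF s] by simp
  show "finite_measure M"
    by (rule finite_measureI) (simp add: sp em)
  show "measure M = \<eta>"
  proof
    show "measure M A = \<eta> A" for A
      using \<eta> nonneg em[of A] s
      by (cases "A \<in> sets borel") (auto simp: measure_def measure_notin_sets finite_signed_measure_def emeasure_notin_sets)
  qed
qed

text \<open>A Hahn set \<open>P\<close> for the pair splits the difference: its restriction to
  \<open>P\<close> is nonnegative and becomes \<open>p\<close>, and its negated restriction to
  \<open>- P\<close> becomes \<open>n\<close>.\<close>

lemma jordan_decomposition_exists: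
  fixes \<nu> \<mu> :: "'a::topological_space measure"
  assumes \<nu>: "sets \<nu> = sets borel" "finite_measure \<nu>" and \<mu>: "sets \<mu> = sets borel" "finite_measure \<mu>"
  obtains p n where "jordan_decomposition (measure_diff \<nu> \<mu>) p n"
proof -
  interpret n: finite_measure \<nu> by fact
  interpret m: finite_measure \<mu> by fact
  let ?\<eta> = "measure_diff \<nu> \<mu>"
  obtain P where P: "P \<in> sets \<nu>"
    and pos: "\<And>X. X \<in> sets \<nu> \<Longrightarrow> X \<subseteq> P \<Longrightarrow> emeasure \<mu> X \<le> emeasure \<nu> X"
    and neg: "\<And>X. X \<in> sets \<nu> \<Longrightarrow> X \<inter> P = {} \<Longrightarrow> emeasure \<nu> X \<le> emeasure \<mu> X"
    using unsigned_Hahn_decomposition[of \<mu> \<nu> UNIV] \<nu> \<mu> by auto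
  have PB: "P \<in> sets borel" "- P \<in> sets borel" using P \<nu> by auto
  have fsm: "finite_signed_measure ?\<eta>"
    using finite_signed_measure_measure_diff assms by auto
  let ?p = "\<lambda>A. if A \<in> sets borel then ?\<eta> (A \<inter> P) else 0"
  let ?n = "\<lambda>A. if A \<in> sets borel then - ?\<eta> (A \<inter> - P) else 0"
  have fp: "finite_signed_measure ?p" by (rule finite_signed_measure_restrict[OF fsm PB(1)])
  have fn: "finite_signed_measure ?n"
    by (rule finite_signed_measure_restrict[OF finite_signed_measure_uminus[OF fsm] PB(2)])
  have np: "\<forall>A\<in>sets borel. 0 \<le> ?p A"
    using pos PB \<nu> by (simp add: measure_diff_def n.emeasure_eq_measure m.emeasure_eq_measure)
  have nn: "\<forall>A\<in>sets borel. 0 \<le> ?n A"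
    using neg PB \<nu>
    by (simp add: measure_diff_def n.emeasure_eq_measure m.emeasure_eq_measure Int_assoc)
  note p = measure_of_finite_signed_measure[OF fp np]
  note n = measure_of_finite_signed_measure[OF fn nn]
  have eq: "?\<eta> A = ?p A - ?n A" if "A \<in> sets borel" for A
  proof -
    have "A = (A \<inter> P) \<union> (A \<inter> - P)" "(A \<inter> P) \<inter> (A \<inter> - P) = {}" by auto
    then show ?thesis
      using that PB \<nu> \<mu> n.finite_measure_Union[of "A \<inter> P" "A \<inter> - P"]
        m.finite_measure_Union[of "A \<inter> P" "A \<inter> - P"]
      by (simp add: measure_diff_def)
  qed
  have null: "?p (- P) = 0" "?n P = 0" by (auto simp: measure_diff_def)
  show thesis
  proof (rule that, unfold jordan_decomposition_def, intro conjI)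
    let ?M = "\<lambda>\<eta>. measure_of UNIV (sets borel) (\<lambda>A. ennreal (\<eta> A))"
    show "sets (?M ?p) = sets borel" "finite_measure (?M ?p)" "sets (?M ?n) = sets borel" "finite_measure (?M ?n)"
      by (rule p n)+
    show "\<exists>P\<in>sets borel. measure (?M ?p) (- P) = 0 \<and> measure (?M ?n) P = 0"
      unfolding p(3) n(3) using PB(1) null by (intro bexI[of _ P] conjI)
    show "\<forall>A\<in>sets borel. ?\<eta> A = measure (?M ?p) A - measure (?M ?n) A"
      unfolding p(3) n(3) using eq by (rule ballI)
  qed
qed

text \<open>Since \<open>p\<close> is carried by \<open>P\<close> and \<open>n\<close> by
  \<open>- P\<close>, the two total masses are values of \<eta> and of its negation. With
  \<open>jordan_decomposition_bounds\<close>, they are in fact the maxima of \<eta> and of its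
  negation over the Borel sets.\<close>

lemma jordan_decompositionE:
  assumes "jordan_decomposition \<eta> p n"
  obtains P where "P \<in> sets borel" "- P \<in> sets borel"
    "\<eta> P = measure p UNIV" "\<eta> (- P) = - measure n UNIV"
proof -
  from assms obtain P where P: "P \<in> sets borel" "measure p (- P) = 0" "measure n P = 0"
    and *: "sets p = sets borel" "finite_measure p" "sets n = sets borel" "finite_measure n"
    and \<eta>: "\<And>A. A \<in> sets borel \<Longrightarrow> \<eta> A = measure p A - measure n A"
    unfolding jordan_decomposition_def by auto
  have PB: "- P \<in> sets borel" using P by auto
  have "measure p UNIV = measure p P + measure p (- P)"
    using finite_measure.finite_measure_Union[of p P "- P"] * P PB by (simp add: Un_commute)
  moreover have "measure n UNIV = measure n P + measure n (- P)"
    using finite_measure.finite_measure_Union[of n P "- P"] * P PB by (simp add: Un_commute)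
  ultimately show thesis using P PB \<eta>[of P] \<eta>[OF PB] by (intro that) auto
qed

lemma jordan_decomposition_bounds:
  assumes "jordan_decomposition \<eta> p n" "A \<in> sets borel"
  shows "\<eta> A \<le> measure p UNIV" "- \<eta> A \<le> measure n UNIV"
proof -
  have *: "measure M A \<le> measure M UNIV" if "finite_measure M" "sets M = sets borel" for M
    using that by (intro finite_measure.finite_measure_mono) auto
  have "\<eta> A = measure p A - measure n A"
    "measure p A \<le> measure p UNIV" "measure n A \<le> measure n UNIV"
    using assms * by (auto simp: jordan_decomposition_def)
  then show "\<eta> A \<le> measure p UNIV" "- \<eta> A \<le> measure n UNIV"
    using measure_nonneg[of p A] measure_nonneg[of n A] by linarith+
qed

section \<open>The total variation norm and its agreement with the partition supremum\<close>

text \<open>The total masses are maxima that depend on \<eta> alone, so every Jordan decomposition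
  gives the same sum and the definite description in \<open>tv_norm\<close> is well defined.\<close>

lemma tv_norm_eq:
  assumes "jordan_decomposition \<eta> p n"
  shows "tv_norm \<eta> = measure p UNIV + measure n UNIV"
  unfolding tv_norm_def
proof (rule the_equality)
  \<comment> \<open>The Hahn set of the first decomposition attains its masses, and the second
    decomposition bounds \<eta> there. Stated for arbitrary pairs, the inequality can be used in
    both directions.\<close>
  have le: "measure p UNIV \<le> measure p' UNIV \<and> measure n UNIV \<le> measure n' UNIV"
    if "jordan_decomposition \<eta> p n" "jordan_decomposition \<eta> p' n'" for p n p' n'
    using that(1)
  proof (rule jordan_decompositionE)
    fix P assume "P \<in> sets borel" "- P \<in> sets borel"
      "\<eta> P = measure p UNIV" "\<eta> (- P) = - measure n UNIV"
    then show ?thesis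
      using jordan_decomposition_bounds[OF that(2), of P] jordan_decomposition_bounds[OF that(2), of "- P"] by auto
  qed
  fix t assume "\<exists>p n. jordan_decomposition \<eta> p n \<and> t = measure p UNIV + measure n UNIV"
  then show "t = measure p UNIV + measure n UNIV"
    using le[OF assms] le[OF _ assms] by (metis order_antisym)
qed (use assms in blast)

text \<open>The supremum over partitions is a maximum, attained by splitting the space into a Hahn
  set and its complement. For any other partition, the triangle inequality on each block and
  additivity of \<open>p\<close> and \<open>n\<close> give the upper bound.\<close>

lemma tv_dist_eq_tv_norm:
  fixes \<nu> \<mu> :: "'a::topological_space measure"
  assumes "sets \<nu> = sets borel" "finite_measure \<nu>" "sets \<mu> = sets borel" "finite_measure \<mu>"
  shows "tv_dist \<nu> \<mu> = tv_norm (measure_diff \<nu> \<mu>)"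
proof -
  let ?\<eta> = "measure_diff \<nu> \<mu>"
  obtain p n where J: "jordan_decomposition ?\<eta> p n"
    using jordan_decomposition_exists assms by blast
  then have pn: "sets p = sets borel" "finite_measure p" "sets n = sets borel" "finite_measure n"
    and \<eta>: "\<And>A. A \<in> sets borel \<Longrightarrow> ?\<eta> A = measure p A - measure n A"
    by (auto simp: jordan_decomposition_def)
  have total: "(\<Sum>F\<in>\<P>. measure M F) = measure M UNIV"
    if "finite_measure M" "sets M = sets borel" "finite \<P>" "\<P> \<subseteq> sets borel" "partition_on UNIV \<P>"
    for M :: "'a measure" and \<P>
  proof -
    have "measure M (\<Union>F\<in>\<P>. F) = (\<Sum>F\<in>\<P>. measure M F)"
      using that by (intro finite_measure.finite_measure_finite_Union)
        (auto simp: partition_on_def disjoint_def disjoint_family_on_def)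
    then show ?thesis using that by (simp add: partition_on_def)
  qed
  obtain P where P: "P \<in> sets borel" "- P \<in> sets borel"
    "?\<eta> P = measure p UNIV" "?\<eta> (- P) = - measure n UNIV"
    using J by (rule jordan_decompositionE)
  \<comment> \<open>The blocks of a \<open>partition_on\<close> are nonempty, but \<open>P\<close>
    or its complement may be empty; dropping the empty set leaves the sum unchanged.\<close>
  let ?\<P> = "{P, - P} - {{}}"
  have "tv_dist \<nu> \<mu> = measure p UNIV + measure n UNIV"
    unfolding tv_dist_def
  proof (rule cSup_eq_maximum)
    have "(\<Sum>F\<in>?\<P>. \<bar>?\<eta> F\<bar>) = (\<Sum>F\<in>{P, - P}. \<bar>?\<eta> F\<bar>)"
      by (rule sum.mono_neutral_left) (auto simp: measure_diff_def)
    also have "\<dots> = \<bar>?\<eta> P\<bar> + \<bar>?\<eta> (- P)\<bar>"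
      by (subst sum.insert) auto
    also have "\<dots> = measure p UNIV + measure n UNIV"
      using P by simp
    finally have "measure p UNIV + measure n UNIV = (\<Sum>F\<in>?\<P>. \<bar>measure \<nu> F - measure \<mu> F\<bar>)"
      by (simp add: measure_diff_def)
    moreover have "finite ?\<P> \<and> ?\<P> \<subseteq> sets borel \<and> partition_on UNIV ?\<P>"
      using P by (auto simp: partition_on_def disjoint_def)
    ultimately show "measure p UNIV + measure n UNIV \<in>
        (\<lambda>\<P>. \<Sum>F\<in>\<P>. \<bar>measure \<nu> F - measure \<mu> F\<bar>) `
          {\<P>. finite \<P> \<and> \<P> \<subseteq> sets borel \<and> partition_on UNIV \<P>}"
      by blast
  next
    fix t assume "t \<in> (\<lambda>\<P>. \<Sum>F\<in>\<P>. \<bar>measure \<nu> F - measure \<mu> F\<bar>) `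
          {\<P>. finite \<P> \<and> \<P> \<subseteq> sets borel \<and> partition_on UNIV \<P>}"
    then obtain \<P> where \<P>: "finite \<P>" "\<P> \<subseteq> sets borel" "partition_on UNIV \<P>"
      and t: "t = (\<Sum>F\<in>\<P>. \<bar>?\<eta> F\<bar>)"
      by (auto simp: measure_diff_def)
    have "t \<le> (\<Sum>F\<in>\<P>. measure p F + measure n F)"
      unfolding t
    proof (rule sum_mono)
      fix F assume "F \<in> \<P>"
      then have "?\<eta> F = measure p F - measure n F"
        using \<eta> \<P> by blast
      then show "\<bar>?\<eta> F\<bar> \<le> measure p F + measure n F"
        using measure_nonneg[of p F] measure_nonneg[of n F] by linarith
    qed
    also have "\<dots> = measure p UNIV + measure n UNIV"
      using \<P> pn total by (simp add: sum.distrib)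
    finally show "t \<le> measure p UNIV + measure n UNIV" .
  qed
  then show ?thesis using tv_norm_eq[OF J] by simp
qed

section \<open>Integrals of a function against differences of measures\<close>

text \<open>An equality of differences of finite measures becomes an equality of sums, which makes
  sense in \<open>ennreal\<close> without subtraction. It extends from indicators to all nonnegative
  measurable functions by linearity and monotone convergence.\<close>

lemma nn_integral_add_measures_cong:
  fixes f :: "'a \<Rightarrow> ennreal"
  assumes sets: "sets A = sets M" "sets B = sets M" "sets C = sets M" "sets D = sets M"
    and eq: "\<And>X. X \<in> sets M \<Longrightarrow> emeasure A X + emeasure B X = emeasure C X + emeasure D X"
    and "f \<in> borel_measurable M"
  shows "(\<integral>\<^sup>+x. f x \<partial>A) + (\<integral>\<^sup>+x. f x \<partial>B) = (\<integral>\<^sup>+x. f x \<partial>C) + (\<integral>\<^sup>+x. f x \<partial>D)"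
proof -
  note [measurable_cong] = sets
  have sp: "space A = space M" "space B = space M" "space C = space M" "space D = space M"
    using sets sets_eq_imp_space_eq by blast+
  show ?thesis
    using \<open>f \<in> borel_measurable M\<close>
  proof (induction rule: borel_measurable_induct)
    case (cong f g)
    have "(\<integral>\<^sup>+x. f x \<partial>N) = (\<integral>\<^sup>+x. g x \<partial>N)" if "space N = space M" for N
      using cong(3) that by (intro nn_integral_cong) simp
    with cong(4) sp show ?case by simp
  next
    case (set X)
    then show ?case using eq sets by simp
  next
    case (mult f c)
    note [measurable] = \<open>f \<in> borel_measurable M\<close>
    from mult show ?case by (simp add: nn_integral_cmult flip: distrib_left)
  next
    case (add f g)
    note [measurable] = \<open>f \<in> borel_measurable M\<close> \<open>g \<in> borel_measurable M\<close>
    have "(\<integral>\<^sup>+x. f x + g x \<partial>A) + (\<integral>\<^sup>+x. f x + g x \<partial>B)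
        = ((\<integral>\<^sup>+x. f x \<partial>A) + (\<integral>\<^sup>+x. f x \<partial>B)) + ((\<integral>\<^sup>+x. g x \<partial>A) + (\<integral>\<^sup>+x. g x \<partial>B))"
      by (simp add: nn_integral_add ac_simps)
    also have "\<dots> = (\<integral>\<^sup>+x. f x + g x \<partial>C) + (\<integral>\<^sup>+x. f x + g x \<partial>D)"
      unfolding add by (simp add: nn_integral_add ac_simps)
    finally show ?case by (simp add: ac_simps)
  next
    case (seq U)
    have [measurable]: "U i \<in> borel_measurable M" for i by (rule seq)
    have inc: "incseq (\<lambda>i. \<integral>\<^sup>+x. U i x \<partial>N)" for N
      using \<open>incseq U\<close> by (auto simp: incseq_def le_fun_def intro!: nn_integral_mono)
    have lim: "(\<integral>\<^sup>+x. (SUP i. U i) x \<partial>N) = (SUP i. \<integral>\<^sup>+x. U i x \<partial>N)" if [measurable_cong]: "sets N = sets M" for N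
      unfolding SUP_apply using \<open>incseq U\<close> by (intro nn_integral_monotone_convergence_SUP) auto
    show ?case
      unfolding lim[OF sets(1)] lim[OF sets(2)] lim[OF sets(3)] lim[OF sets(4)]
      \<comment> \<open>Both sequences of integrals increase, so the sum of the two suprema is the
        supremum of the termwise sums, to which the induction hypothesis applies.\<close>
      by (simp add: ennreal_SUP_add[OF inc inc, symmetric] seq)
  qed
qed

lemma integrable_bounded_range:
  fixes f :: "'a::topological_space \<Rightarrow> real"
  assumes "sets N = sets borel" "finite_measure N" "f \<in> borel_measurable borel" "bounded (range f)"
  shows "integrable N f"
proof -
  obtain B where "\<And>x. norm (f x) \<le> B" using assms(4) by (auto simp: bounded_iff)
  moreover have "f \<in> borel_measurable N" using assms measurable_cong_sets by blast
  ultimately show ?thesis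
    using assms(2) by (intro finite_measure.integrable_const_bound[where B = B]) auto
qed

text \<open>Moving the negative terms across turns the hypothesis into
  \<open>\<nu> + n = \<mu> + p\<close> on Borel sets. Boundedness of \<open>f\<close> on finite
  measures makes all four integrals finite, so the resulting identity of nonnegative integrals can
  be rearranged in the reals.\<close>

lemma integral_diff_measures_cong:
  fixes f :: "'a::topological_space \<Rightarrow> real"
  assumes sets: "sets \<nu> = sets borel" "sets \<mu> = sets borel" "sets p = sets borel" "sets n = sets borel"
    and fin: "finite_measure \<nu>" "finite_measure \<mu>" "finite_measure p" "finite_measure n"
    and eq: "\<And>A. A \<in> sets borel \<Longrightarrow> measure \<nu> A - measure \<mu> A = measure p A - measure n A"
    and f: "f \<in> borel_measurable borel" "\<And>x. 0 \<le> f x" "bounded (range f)"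
  shows "(\<integral>x. f x \<partial>\<nu>) - (\<integral>x. f x \<partial>\<mu>) = (\<integral>x. f x \<partial>p) - (\<integral>x. f x \<partial>n)"
proof -
  have nn: "(\<integral>\<^sup>+x. f x \<partial>N) = ennreal (\<integral>x. f x \<partial>N)" if "sets N = sets borel" "finite_measure N" for N
    using that f integrable_bounded_range[OF that f(1,3)] by (intro nn_integral_eq_integral) auto
  have "emeasure \<nu> A + emeasure n A = emeasure \<mu> A + emeasure p A" if "A \<in> sets borel" for A
    using eq[OF that] fin
    by (simp add: finite_measure.emeasure_eq_measure flip: ennreal_plus)
  then have "(\<integral>\<^sup>+x. f x \<partial>\<nu>) + (\<integral>\<^sup>+x. f x \<partial>n) = (\<integral>\<^sup>+x. f x \<partial>\<mu>) + (\<integral>\<^sup>+x. f x \<partial>p)"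
    using sets f(1) by (intro nn_integral_add_measures_cong[where M = borel]) auto
  then show ?thesis
    using nn sets fin f(2) by (simp add: flip: ennreal_plus)
qed

lemma integral_ge_INF_SUP_tv_norm:
  fixes \<mu> :: "'a::topological_space measure" and l :: "'a \<Rightarrow> real"
  assumes \<nu>: "\<nu> \<in> prob_measures" and \<mu>: "\<mu> \<in> prob_measures"
    and l: "l \<in> borel_measurable borel" "\<And>x. 0 \<le> l x" "bounded (range l)"
  shows "((INF x. l x) - (SUP x. l x)) * (tv_norm (measure_diff \<nu> \<mu>) / 2) + (\<integral>x. l x \<partial>\<mu>)
    \<le> (\<integral>x. l x \<partial>\<nu>)"
proof -
  have n: "sets \<nu> = sets borel" "prob_space \<nu>" "finite_measure \<nu>"
    and m: "sets \<mu> = sets borel" "prob_space \<mu>" "finite_measure \<mu>"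
    using \<nu> \<mu> prob_space.finite_measure by (auto simp: prob_measures_def)
  have sp: "space N = UNIV" if "sets N = sets borel" for N :: "'a measure"
    using sets_eq_imp_space_eq[OF that] by simp
  obtain p q where J: "jordan_decomposition (measure_diff \<nu> \<mu>) p q"
    using jordan_decomposition_exists n m by blast
  then have p: "sets p = sets borel" "finite_measure p" and q: "sets q = sets borel" "finite_measure q"
    and eq: "\<And>A. A \<in> sets borel \<Longrightarrow> measure \<nu> A - measure \<mu> A = measure p A - measure q A"
    by (auto simp: jordan_decomposition_def measure_diff_def)
  \<comment> \<open>Two probability measures differ by a signed measure of total mass
    \<open>0\<close>; hence each Jordan part carries half of the norm.\<close>
  have pq: "measure p UNIV = measure q UNIV"
    using eq[of UNIV] prob_space.prob_space[OF n(2)] prob_space.prob_space[OF m(2)] sp n(1) m(1) by simp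
  have tv: "tv_norm (measure_diff \<nu> \<mu>) / 2 = measure p UNIV"
    using tv_norm_eq[OF J] pq by simp
  have bdd: "bdd_below (range l)" "bdd_above (range l)"
    using l(3) bounded_imp_bdd_below bounded_imp_bdd_above by auto
  have "(INF x. l x) * measure p UNIV = (\<integral>x. (INF x. l x) \<partial>p)"
    using sp[OF p(1)] by simp
  also have "\<dots> \<le> (\<integral>x. l x \<partial>p)"
    using p l bdd by (intro integral_mono integrable_bounded_range cINF_lower) auto
  finally have 1: "(INF x. l x) * measure p UNIV \<le> (\<integral>x. l x \<partial>p)" .
  have "(\<integral>x. l x \<partial>q) \<le> (\<integral>x. (SUP x. l x) \<partial>q)"
    using q l bdd by (intro integral_mono integrable_bounded_range cSUP_upper) auto
  also have "\<dots> = (SUP x. l x) * measure p UNIV"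
    using sp[OF q(1)] pq by simp
  finally have 2: "(\<integral>x. l x \<partial>q) \<le> (SUP x. l x) * measure p UNIV" .
  have "(\<integral>x. l x \<partial>\<nu>) - (\<integral>x. l x \<partial>\<mu>) = (\<integral>x. l x \<partial>p) - (\<integral>x. l x \<partial>q)"
    using n m p q eq l by (intro integral_diff_measures_cong) auto
  then show ?thesis using 1 2 tv by (simp add: left_diff_distrib)
qed

section \<open>The extremal signed measure \<xi>* and the measure \<nu>*\<close>

lemma finite_measure_scale_return:
  fixes a :: "'a::topological_space"
  assumes "0 \<le> c"
  shows "finite_measure (scale_measure (ennreal c) (return borel a))"
    "measure (scale_measure (ennreal c) (return borel a)) A = c * measure (return borel a) A"
  using assms by (auto intro!: finite_measureI
      simp: ennreal_mult_eq_top_iff measure_def enn2real_mult space_scale_measure emeasure_return)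

text \<open>The singleton of \<open>xmin\<close>, Borel because points are closed in a T1 space,
  separates the two Dirac masses as soon as the points differ. If they coincided, the masses would
  cancel, and for positive \<open>R\<close> these two measures would not be mutually
  singular.\<close>

lemma jordan_decomposition_xi_star:
  fixes xmin xmax :: "'a::t1_space"
  assumes "0 \<le> R" "xmin \<noteq> xmax"
  shows "jordan_decomposition (xi_star R xmin xmax)
    (scale_measure (ennreal (R / 2)) (return borel xmin))
    (scale_measure (ennreal (R / 2)) (return borel xmax))"
proof -
  have "{xmin} \<in> sets borel" by simp
  then show ?thesis
    using assms unfolding jordan_decomposition_def
    by (auto simp: finite_measure_scale_return xi_star_def algebra_simps measure_return
        intro!: bexI[of _ "{xmin}"])
qed

lemma tv_norm_xi_star:
  fixes xmin xmax :: "'a::t1_space"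
  assumes "0 \<le> R" "xmin \<noteq> xmax"
  shows "tv_norm (xi_star R xmin xmax) = R"
  using tv_norm_eq[OF jordan_decomposition_xi_star[OF assms]] assms
  by (simp add: finite_measure_scale_return measure_return)

text \<open>This covers the degenerate case \<open>xmin = xmax\<close>, in which \<xi>*
  vanishes.\<close>

lemma tv_norm_zero: "tv_norm (\<lambda>A :: 'a::topological_space set. 0) = 0"
proof -
  have "jordan_decomposition (\<lambda>A :: 'a set. 0) (null_measure borel) (null_measure borel)"
    by (auto simp: jordan_decomposition_def intro!: finite_measureI bexI[of _ UNIV])
  from tv_norm_eq[OF this] show ?thesis by simp
qed

lemma nu_star_UNIV:
  assumes "\<mu> \<in> prob_measures"
  shows "nu_star \<mu> R xmin xmax UNIV = 1"
proof -
  have "sets \<mu> = sets borel" "prob_space \<mu>" using assms by (auto simp: prob_measures_def)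
  then have "measure \<mu> UNIV = 1"
    using prob_space.prob_space[of \<mu>] sets_eq_imp_space_eq[of \<mu> borel] by simp
  then show ?thesis by (simp add: nu_star_def xi_star_def measure_return)
qed

text \<open>\<nu>* is countably additive as a combination of finite measures and has total mass
  \<open>1\<close>, so nonnegativity is all that separates it from a probability measure.\<close>

lemma nu_star_measure:
  assumes \<mu>: "\<mu> \<in> prob_measures" and nonneg: "\<And>A. A \<in> sets borel \<Longrightarrow> 0 \<le> nu_star \<mu> R xmin xmax A"
  shows "nu_star_measure \<mu> R xmin xmax \<in> prob_measures"
    "measure (nu_star_measure \<mu> R xmin xmax) = nu_star \<mu> R xmin xmax"
proof -
  have m: "sets \<mu> = sets borel" "finite_measure \<mu>"
    using \<mu> prob_space.finite_measure by (auto simp: prob_measures_def)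
  have r: "finite_measure (return borel x)" for x :: 'a
    by (simp add: prob_space_return prob_space.finite_measure)
  have sums: "(\<lambda>n. measure \<mu> (A n)) sums measure \<mu> (\<Union>n. A n)"
    "(\<lambda>n. measure (return borel x) (A n)) sums measure (return borel x) (\<Union>n. A n)"
    if "range A \<subseteq> sets borel" "disjoint_family A" for A :: "nat \<Rightarrow> 'a set" and x
    using that m r by (auto intro!: finite_measure.finite_measure_UNION)
  have "finite_signed_measure (nu_star \<mu> R xmin xmax)"
    unfolding finite_signed_measure_def nu_star_def xi_star_def
  proof (intro conjI allI impI)
    fix A :: "nat \<Rightarrow> 'a set" assume A: "range A \<subseteq> sets borel" "disjoint_family A"
    show "(\<lambda>n. measure \<mu> (A n) + R / 2 * (measure (return borel xmin) (A n) - measure (return borel xmax) (A n))) sums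
      (measure \<mu> (\<Union>n. A n) + R / 2 * (measure (return borel xmin) (\<Union>n. A n) - measure (return borel xmax) (\<Union>n. A n)))"
      by (intro sums_add sums_mult sums_diff sums A)
  qed (use m in \<open>auto simp: measure_notin_sets\<close>)
  note * = measure_of_finite_signed_measure[OF this ballI[OF nonneg], folded nu_star_measure_def]
  show me: "measure (nu_star_measure \<mu> R xmin xmax) = nu_star \<mu> R xmin xmax" by (rule *)
  have "space (nu_star_measure \<mu> R xmin xmax) = UNIV"
    using sets_eq_imp_space_eq[OF *(1)] by simp
  then have "prob_space (nu_star_measure \<mu> R xmin xmax)"
    using nu_star_UNIV[OF \<mu>, of R xmin xmax] me *(2)
    by (intro prob_spaceI) (simp add: finite_measure.emeasure_eq_measure)
  with *(1) show "nu_star_measure \<mu> R xmin xmax \<in> prob_measures" by (simp add: prob_measures_def)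
qed

lemma xi_star_eq_measure_diff:
  assumes "\<mu> \<in> prob_measures" "\<And>A. A \<in> sets borel \<Longrightarrow> 0 \<le> nu_star \<mu> R xmin xmax A"
  shows "xi_star R xmin xmax = measure_diff (nu_star_measure \<mu> R xmin xmax) \<mu>"
  using nu_star_measure(2)[OF assms] by (simp add: measure_diff_def nu_star_def)

text \<open>The Dirac masses scaled by \<open>R / 2\<close> serve as \<open>p\<close> and
  \<open>n\<close> in \<open>integral_diff_measures_cong\<close>; this also covers
  \<open>xmin = xmax\<close>.\<close>

lemma integral_nu_star_measure:
  fixes l :: "'a::topological_space \<Rightarrow> real"
  assumes \<mu>: "\<mu> \<in> prob_measures" and nonneg: "\<And>A. A \<in> sets borel \<Longrightarrow> 0 \<le> nu_star \<mu> R xmin xmax A"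
    and "0 \<le> R" and l: "l \<in> borel_measurable borel" "\<And>x. 0 \<le> l x" "bounded (range l)"
  shows "(\<integral>x. l x \<partial>nu_star_measure \<mu> R xmin xmax) = R / 2 * (l xmin - l xmax) + (\<integral>x. l x \<partial>\<mu>)"
proof -
  let ?r = "\<lambda>x :: 'a. scale_measure (ennreal (R / 2)) (return borel x)"
  have "sets N = sets borel" "finite_measure N" if "N \<in> prob_measures" for N :: "'a measure"
    using that prob_space.finite_measure by (auto simp: prob_measures_def)
  note * = this[OF \<mu>] this[OF nu_star_measure(1)[OF \<mu> nonneg]]
  have r: "(\<integral>x. l x \<partial>?r y) = R / 2 * l y" for y
  proof -
    have "(\<integral>x. l x \<partial>?r y) = enn2real (\<integral>\<^sup>+x. l x \<partial>?r y)"
      using l measurable_cong_sets[of "?r y" borel borel borel]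
      by (intro integral_eq_nn_integral) auto
    also have "(\<integral>\<^sup>+x. l x \<partial>?r y) = ennreal (R / 2) * ennreal (l y)"
      using l by (simp add: nn_integral_scale_measure nn_integral_return)
    finally show ?thesis using l \<open>0 \<le> R\<close> by (simp add: enn2real_mult)
  qed
  have "(\<integral>x. l x \<partial>nu_star_measure \<mu> R xmin xmax) - (\<integral>x. l x \<partial>\<mu>) = (\<integral>x. l x \<partial>?r xmin) - (\<integral>x. l x \<partial>?r xmax)"
    using * l \<open>0 \<le> R\<close>
    by (intro integral_diff_measures_cong)
      (auto simp: finite_measure_scale_return nu_star_measure(2)[OF \<mu> nonneg] nu_star_def xi_star_def algebra_simps)
  then show ?thesis by (simp add: r right_diff_distrib)
qed

section \<open>Attainment of the lower bound and the value of \<open>R_minus\<close>\<close>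

theorem mainTheorem5:
  fixes \<mu> :: "'a::polish_space measure" and l :: "'a \<Rightarrow> real"
  assumes "\<mu> \<in> prob_measures"
    and "continuous_on UNIV l" and "\<And>x. 0 \<le> l x" and "bounded (range l)"
  shows
    "(\<forall>\<nu>\<in>prob_measures.
        (\<integral>x. l x \<partial>\<nu>) \<ge> ((INF x. l x) - (SUP x. l x)) * (tv_norm (measure_diff \<nu> \<mu>) / 2)
                      + (\<integral>x. l x \<partial>\<mu>))
   \<and> (\<forall>xmax\<in>argmax_set l. \<forall>xmin\<in>argmin_set l.
        (\<forall>R\<ge>0. (\<forall>A\<in>sets borel. 0 \<le> nu_star \<mu> R xmin xmax A) \<longrightarrow>
           nu_star_measure \<mu> R xmin xmax \<in> prob_measures
         \<and> xi_star R xmin xmax = measure_diff (nu_star_measure \<mu> R xmin xmax) \<mu>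
         \<and> xi_star R xmin xmax \<in> signed_ball \<mu> R
         \<and> (xmin \<noteq> xmax \<longrightarrow>
              tv_norm (xi_star R xmin xmax) = R
            \<and> tv_dist (nu_star_measure \<mu> R xmin xmax) \<mu> = R)
         \<and> (\<integral>x. l x \<partial>nu_star_measure \<mu> R xmin xmax)
             = ((INF x. l x) - (SUP x. l x)) * (tv_norm (xi_star R xmin xmax) / 2)
               + (\<integral>x. l x \<partial>\<mu>)
         \<and> (\<integral>x. l x \<partial>nu_star_measure \<mu> R xmin xmax)
             = R / 2 * ((INF x. l x) - (SUP x. l x)) + (\<integral>x. l x \<partial>\<mu>))
      \<and> (\<forall>D R. 0 \<le> D \<longrightarrow> D < (\<integral>x. l x \<partial>\<mu>) \<longrightarrow> (INF x. l x) \<noteq> (SUP x. l x) \<longrightarrow>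
           R = 2 * (D - (\<integral>x. l x \<partial>\<mu>)) / ((INF x. l x) - (SUP x. l x)) \<longrightarrow>
           (\<forall>A\<in>sets borel. 0 \<le> nu_star \<mu> R xmin xmax A) \<longrightarrow>
           R_minus \<mu> l D = ereal R
         \<and> (\<integral>x. l x \<partial>nu_star_measure \<mu> R xmin xmax) = D
         \<and> nu_star \<mu> R xmin xmax UNIV = 1
         \<and> (\<forall>A\<in>sets borel. 0 \<le> nu_star \<mu> R xmin xmax A \<and> nu_star \<mu> R xmin xmax A \<le> 1)))"
proof -
  note \<mu> = assms(1)
  have l: "l \<in> borel_measurable borel" "\<And>x. 0 \<le> l x" "bounded (range l)"
    using assms borel_measurable_continuous_onI by auto
  have fin: "sets N = sets borel" "finite_measure N" if "N \<in> prob_measures" for N :: "'a measure"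
    using that prob_space.finite_measure by (auto simp: prob_measures_def)
  note lower = integral_ge_INF_SUP_tv_norm[OF _ \<mu> l]
  let ?d = "(INF x. l x) - (SUP x. l x)"
  have attained: "nu_star_measure \<mu> R xmin xmax \<in> prob_measures \<and> \<xi> = measure_diff (nu_star_measure \<mu> R xmin xmax) \<mu> \<and> \<xi> \<in> signed_ball \<mu> R
      \<and> (xmin \<noteq> xmax \<longrightarrow> tv_norm \<xi> = R \<and> tv_dist (nu_star_measure \<mu> R xmin xmax) \<mu> = R)
      \<and> (\<integral>x. l x \<partial>nu_star_measure \<mu> R xmin xmax) = ?d * (tv_norm \<xi> / 2) + (\<integral>x. l x \<partial>\<mu>)
      \<and> (\<integral>x. l x \<partial>nu_star_measure \<mu> R xmin xmax) = R / 2 * ?d + (\<integral>x. l x \<partial>\<mu>)"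
    if ext: "xmax \<in> argmax_set l" "xmin \<in> argmin_set l" and "0 \<le> R"
      and nonneg: "\<And>A. A \<in> sets borel \<Longrightarrow> 0 \<le> nu_star \<mu> R xmin xmax A"
      and \<xi>_def: "\<xi> = xi_star R xmin xmax"
    for xmin xmax R \<xi>
  proof -
    let ?N = "nu_star_measure \<mu> R xmin xmax"
    have N: "?N \<in> prob_measures" by (rule nu_star_measure(1)[OF \<mu> nonneg])
    have \<xi>: "\<xi> = measure_diff ?N \<mu>"
      unfolding \<xi>_def by (rule xi_star_eq_measure_diff[OF \<mu> nonneg])
    \<comment> \<open>When the points coincide, the norm is \<open>0\<close> rather than
      \<open>R\<close>. Then \<open>l\<close> has equal infimum and supremum, so
      \<open>?d = 0\<close> and both formulas for the integral still hold.\<close>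
    have tv: "tv_norm \<xi> = (if xmin = xmax then 0 else R)"
    proof (cases "xmin = xmax")
      case True
      then have "\<xi> = (\<lambda>A. 0)" by (simp add: \<xi>_def xi_star_def)
      with True show ?thesis by (simp add: tv_norm_zero)
    qed (simp add: \<xi>_def tv_norm_xi_star \<open>0 \<le> R\<close>)
    have "\<xi> UNIV = 0"
      by (simp add: \<xi>_def xi_star_def measure_return)
    moreover have "finite_signed_measure \<xi>"
      unfolding \<xi> by (rule finite_signed_measure_measure_diff[OF fin[OF N] fin[OF \<mu>]])
    ultimately have "\<xi> \<in> signed_ball \<mu> R"
      unfolding signed_ball_def using N \<xi> tv \<open>0 \<le> R\<close> by auto
    moreover have "tv_dist ?N \<mu> = tv_norm \<xi>"
      using tv_dist_eq_tv_norm[OF fin[OF N] fin[OF \<mu>]] \<xi> by simp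
    moreover have d: "?d = l xmin - l xmax"
      using ext by (simp add: argmax_set_def argmin_set_def)
    moreover have "(\<integral>x. l x \<partial>?N) = R / 2 * ?d + (\<integral>x. l x \<partial>\<mu>)"
      unfolding d by (rule integral_nu_star_measure[OF \<mu> nonneg \<open>0 \<le> R\<close> l])
    ultimately show ?thesis using N \<xi> tv by auto
  qed
  have solved: "R_minus \<mu> l D = ereal R \<and> (\<integral>x. l x \<partial>nu_star_measure \<mu> R xmin xmax) = D \<and> nu_star \<mu> R xmin xmax UNIV = 1
      \<and> (\<forall>A\<in>sets borel. 0 \<le> nu_star \<mu> R xmin xmax A \<and> nu_star \<mu> R xmin xmax A \<le> 1)"
    if ext: "xmax \<in> argmax_set l" "xmin \<in> argmin_set l"
      and D: "D < (\<integral>x. l x \<partial>\<mu>)" and ne: "(INF x. l x) \<noteq> (SUP x. l x)"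
      and R: "R = 2 * (D - (\<integral>x. l x \<partial>\<mu>)) / ?d"
      and nonneg: "\<And>A. A \<in> sets borel \<Longrightarrow> 0 \<le> nu_star \<mu> R xmin xmax A"
    for xmin xmax D R
  proof -
    let ?N = "nu_star_measure \<mu> R xmin xmax"
    \<comment> \<open>The signs matter: \<open>?d\<close> is strictly negative and so is
      \<open>D\<close> minus the integral under \<mu>, hence the quotient \<open>R\<close> is
      nonnegative and \<open>attained\<close> applies.\<close>
    have "(INF x. l x) \<le> (SUP x. l x)"
      using l(3) bounded_imp_bdd_below bounded_imp_bdd_above
      by (intro order_trans[OF cINF_lower cSUP_upper]) auto
    with ne have d: "?d < 0" by simp
    have "0 \<le> R" unfolding R using D d by (intro divide_nonpos_neg) auto
    have "xmin \<noteq> xmax" using ext ne by (auto simp: argmax_set_def argmin_set_def)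
    with attained[OF ext \<open>0 \<le> R\<close> nonneg refl]
    have N: "?N \<in> prob_measures" "tv_dist ?N \<mu> = R"
      and int: "(\<integral>x. l x \<partial>?N) = R / 2 * ?d + (\<integral>x. l x \<partial>\<mu>)"
      by auto
    \<comment> \<open>\<open>R\<close> is the radius at which the attained integral equals
      \<open>D\<close>, so \<nu>* is feasible for the infimum.\<close>
    have Rd: "R / 2 * ?d = D - (\<integral>x. l x \<partial>\<mu>)" unfolding R using ne by (simp add: field_simps)
    with int have ND: "(\<integral>x. l x \<partial>?N) = D" by linarith
    have "R_minus \<mu> l D = ereal R"
      unfolding R_minus_def
    proof (rule antisym)
      show "(INF \<nu>\<in>{\<nu> \<in> prob_measures. (\<integral>x. l x \<partial>\<nu>) \<le> D}. ereal (tv_dist \<nu> \<mu>)) \<le> ereal R"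
        using N ND by (intro INF_lower2[of ?N]) auto
      show "ereal R \<le> (INF \<nu>\<in>{\<nu> \<in> prob_measures. (\<integral>x. l x \<partial>\<nu>) \<le> D}. ereal (tv_dist \<nu> \<mu>))"
      proof (rule INF_greatest)
        fix \<nu> assume "\<nu> \<in> {\<nu> \<in> prob_measures. (\<integral>x. l x \<partial>\<nu>) \<le> D}"
        then have \<nu>: "\<nu> \<in> prob_measures" "(\<integral>x. l x \<partial>\<nu>) \<le> D" by auto
        \<comment> \<open>For a feasible \<nu>, the lower bound puts the left side below
          \<open>D\<close> minus the integral under \<mu>, which is the right side by
          \<open>Rd\<close>. Cancelling the negative factor \<open>?d\<close> reverses the
          inequality, so no feasible measure is closer to \<mu> than \<open>R\<close>.\<close>
        then have "?d * (tv_dist \<nu> \<mu> / 2) \<le> ?d * (R / 2)"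
          using lower[OF \<nu>(1)] Rd tv_dist_eq_tv_norm[OF fin[OF \<nu>(1)] fin[OF \<mu>]]
          by (simp add: mult.commute)
        then show "ereal R \<le> ereal (tv_dist \<nu> \<mu>)"
          using d by (simp add: mult_le_cancel_left)
      qed
    qed
    \<comment> \<open>The upper bound comes from \<nu>* being a probability measure.\<close>
    moreover have "nu_star \<mu> R xmin xmax A \<le> 1" for A
      using prob_space.prob_le_1[of ?N A] N(1) nu_star_measure(2)[OF \<mu> nonneg]
      by (simp add: prob_measures_def)
    ultimately show ?thesis using ND nu_star_UNIV[OF \<mu>] nonneg by blast
  qed
  show ?thesis
    by (intro conjI[OF ballI[OF lower]] ballI conjI[OF allI[OF impI[OF impI]] allI[OF allI]] impI)
      (use attained[OF _ _ _ _ refl] solved in \<open>blast+\<close>)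
qed

end
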